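(* Let $\psi\colon \mathbb{R}^2\to\mathbb{R}$ be a $C^3$-differentiable function satisfying the zero mean curvature equation $$(1-\psi_y^2)\psi_{xx}+2\psi_x\psi_y\psi_{xy}+(1-\psi_x^2)\psi_{yy}=0$$ on all of $\mathbb{R}^2$. Suppose that $\psi$ has no time-like points, i.e. $1-\psi_x^2-\psi_y^2\ge 0$ everywhere on $\mathbb{R}^2$. Then the graph of $\psi$ is a plane, i.e. $\psi-\psi(0,0)$ is a linear function.
   Context: Let $\mathbb{L}^3$ be Lorentz-Minkowski 3-space with coordinates $(x,y,t)$ and signature $(++-)$. An entire ZMC-graph (ZMC = zero mean curvature) is the graph $t=\psi(x,y)$ in $\mathbb{L}^3$ of a function $\psi\colon\mathbb{R}^2\to\mathbb{R}$ satisfying the zero mean curvature equation displayed in the claim at every point of $\mathbb{R}^2$. Subscripts denote partial derivatives. Put $B_\psi:=1-\psi_x^2-\psi_y^2$. A point $p\in\mathbb{R}^2$ is space-like if $B_\psi(p)>0$, time-like if $B_\psi(p)<0$, and light-like if $B_\psi(p)=0$. *)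

theory Defs
  imports "HOL-Analysis.Analysis"
begin

definition partial_x :: "(real \<times> real \<Rightarrow> real) \<Rightarrow> real \<times> real \<Rightarrow> real" where
  "partial_x f = (\<lambda>(x, y). deriv (\<lambda>s. f (s, y)) x)"

definition partial_y :: "(real \<times> real \<Rightarrow> real) \<Rightarrow> real \<times> real \<Rightarrow> real" where
  "partial_y f = (\<lambda>(x, y). deriv (\<lambda>s. f (x, s)) y)"

text \<open>
  Class \<open>C\<^sup>k\<close> on the whole plane. Requiring Frechet differentiability, rather than mere
  existence of the partial derivatives, is no restriction: existence and continuity of the
  partial derivatives imply it. It makes the values of \<open>deriv\<close> above the actual partial
  derivatives, since \<open>deriv\<close> is total and unspecified where no derivative exists.
\<close>

primrec C_k :: "nat \<Rightarrow> (real \<times> real \<Rightarrow> real) \<Rightarrow> bool" where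
  "C_k 0 f \<longleftrightarrow> continuous_on UNIV f"
| "C_k (Suc k) f \<longleftrightarrow>
     (\<forall>p. f differentiable (at p)) \<and> C_k k (partial_x f) \<and> C_k k (partial_y f)"

definition zero_mean_curvature_at :: "(real \<times> real \<Rightarrow> real) \<Rightarrow> real \<times> real \<Rightarrow> bool" where
  "zero_mean_curvature_at \<psi> p \<longleftrightarrow>
     (1 - (partial_y \<psi> p)\<^sup>2) * partial_x (partial_x \<psi>) p
     + 2 * partial_x \<psi> p * partial_y \<psi> p * partial_y (partial_x \<psi>) p
     + (1 - (partial_x \<psi> p)\<^sup>2) * partial_y (partial_y \<psi>) p = 0"

definition B :: "(real \<times> real \<Rightarrow> real) \<Rightarrow> real \<times> real \<Rightarrow> real" where
  "B \<psi> p = 1 - (partial_x \<psi> p)\<^sup>2 - (partial_y \<psi> p)\<^sup>2"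

definition time_like :: "(real \<times> real \<Rightarrow> real) \<Rightarrow> real \<times> real \<Rightarrow> bool" where
  "time_like \<psi> p \<longleftrightarrow> B \<psi> p < 0"

end

theory Submission
  imports Defs "HOL-Complex_Analysis.Complex_Analysis"
begin

text \<open>
  If the graph has a light-like point \<open>z0\<close> with gradient \<open>v\<close>, the function \<open>w = 1 - v \<bullet> \<nabla>\<psi>\<close> is
  non-negative and, along the line \<open>z0 + \<tau> v\<close>, the equation gives \<open>\<bar>w'\<bar> \<le> C w\<close>. By Gronwall \<open>w\<close> vanishes
  on the whole line, so the graph contains a complete light-like line. As \<open>\<psi>\<close> is 1-Lipschitz,
  comparing \<open>\<psi> z\<close> with the values far out on both ends of that line forces \<open>\<psi>\<close> to be affine.

  Otherwise the graph is space-like. The rows of the metric divided by its area density are then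
  closed forms, so it is the Hessian of a convex \<open>u\<close> with determinant 1. As in the Jorgens-Nitsche
  proof of Bernstein's theorem, \<open>z + \<nabla>u\<close> is an expanding homeomorphism onto the plane, the conjugate of
  \<open>z - \<nabla>u\<close> is an entire 1-Lipschitz function of it, and Liouville's theorem makes its complex
  derivative constant. That derivative is \<open>((\<psi>\<^sub>x - i \<psi>\<^sub>y) / (1 + W))\<^sup>2\<close> with \<open>W\<^sup>2 = 1 - \<bar>\<nabla>\<psi>\<bar>\<^sup>2\<close>, so the
  gradient is constant.
\<close>

subsection \<open>Gradients of functions on the plane\<close>

text \<open>With the partials named as functions, the predicate can be iterated on \<open>a\<close>
  and \<open>b\<close>, so that higher derivatives are handled without \<open>deriv\<close>.\<close>

definition has_gradient ::
  "(real \<times> real \<Rightarrow> real) \<Rightarrow> (real \<times> real \<Rightarrow> real) \<Rightarrow> (real \<times> real \<Rightarrow> real) \<Rightarrow> bool" where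
  "has_gradient f a b \<longleftrightarrow>
     (\<forall>z. (f has_derivative (\<lambda>h. a z * fst h + b z * snd h)) (at z))"

lemma has_gradientD:
  "has_gradient f a b \<Longrightarrow> (f has_derivative (\<lambda>h. a z * fst h + b z * snd h)) (at z)"
  unfolding has_gradient_def by blast

lemma has_gradient_continuous: "has_gradient f a b \<Longrightarrow> continuous_on S f"
  by (rule has_derivative_continuous_on) (rule has_derivative_at_withinI, erule has_gradientD)

lemma has_gradient_compose:
  assumes f: "has_gradient f a b"
    and u: "(u has_real_derivative u') (at t within S)"
    and v: "(v has_real_derivative v') (at t within S)"
  shows "((\<lambda>t. f (u t, v t)) has_real_derivative
           a (u t, v t) * u' + b (u t, v t) * v') (at t within S)"
proof -
  have "((\<lambda>t. (u t, v t)) has_derivative (\<lambda>h. (u' * h, v' * h))) (at t within S)"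
    using u v unfolding has_field_derivative_def by (rule has_derivative_Pair)
  from has_derivative_compose[OF this has_gradientD[OF f, of "(u t, v t)"]]
  show ?thesis
    unfolding has_field_derivative_def
    by (rule has_derivative_eq_rhs) (auto simp: algebra_simps)
qed

lemma has_gradient_line:
  assumes "has_gradient f a b"
  shows "((\<lambda>t. f (z + t *\<^sub>R v)) has_real_derivative
           fst v * a (z + t *\<^sub>R v) + snd v * b (z + t *\<^sub>R v)) (at t)"
proof -
  have "((\<lambda>t. f (fst z + t * fst v, snd z + t * snd v)) has_real_derivative
     a (fst z + t * fst v, snd z + t * snd v) * fst v + b (fst z + t * fst v, snd z + t * snd v) * snd v) (at t)"
    by (rule has_gradient_compose[OF assms]) (auto intro!: derivative_eq_intros)
  moreover have "(fst z + t * fst v, snd z + t * snd v) = z + t *\<^sub>R v" for t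
    by (simp add: prod_eq_iff)
  ultimately show ?thesis by (simp add: mult.commute)
qed

lemma has_gradient_linear_combination:
  assumes f: "has_gradient f f1 f2" and g: "has_gradient g g1 g2"
  shows "has_gradient (\<lambda>z. a * f z + b * g z) (\<lambda>z. a * f1 z + b * g1 z) (\<lambda>z. a * f2 z + b * g2 z)"
  unfolding has_gradient_def
proof
  fix z
  have "((\<lambda>z. a * f z + b * g z) has_derivative
      (\<lambda>h. a * (f1 z * fst h + f2 z * snd h) + b * (g1 z * fst h + g2 z * snd h))) (at z)"
    by (intro derivative_intros has_gradientD[OF f] has_gradientD[OF g])
  then show "((\<lambda>z. a * f z + b * g z) has_derivative
      (\<lambda>h. (a * f1 z + b * g1 z) * fst h + (a * f2 z + b * g2 z) * snd h)) (at z)"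
    by (rule has_derivative_eq_rhs) (auto simp: algebra_simps)
qed

lemma has_gradient_mult:
  assumes f: "has_gradient f f1 f2" and g: "has_gradient g g1 g2"
  shows "has_gradient (\<lambda>z. f z * g z) (\<lambda>z. f1 z * g z + f z * g1 z) (\<lambda>z. f2 z * g z + f z * g2 z)"
  unfolding has_gradient_def
proof
  fix z
  have "((\<lambda>z. f z * g z) has_derivative
      (\<lambda>h. f z * (g1 z * fst h + g2 z * snd h) + (f1 z * fst h + f2 z * snd h) * g z)) (at z)"
    by (rule has_derivative_mult[OF has_gradientD[OF f] has_gradientD[OF g]])
  then show "((\<lambda>z. f z * g z) has_derivative
      (\<lambda>h. (f1 z * g z + f z * g1 z) * fst h + (f2 z * g z + f z * g2 z) * snd h)) (at z)"
    by (rule has_derivative_eq_rhs) (auto simp: algebra_simps)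
qed

lemma has_gradient_const: "has_gradient (\<lambda>_. c) (\<lambda>_. 0) (\<lambda>_. 0)"
  by (auto simp: has_gradient_def)

lemma has_gradient_diff:
  assumes f: "has_gradient f f1 f2" and g: "has_gradient g g1 g2"
  shows "has_gradient (\<lambda>z. f z - g z) (\<lambda>z. f1 z - g1 z) (\<lambda>z. f2 z - g2 z)"
  using has_gradient_linear_combination[OF f g, of 1 "- 1"] by simp

lemma has_gradient_DERIV:
  assumes f: "has_gradient f f1 f2" and \<phi>: "\<And>z. (\<phi> has_real_derivative \<phi>' z) (at (f z))"
  shows "has_gradient (\<lambda>z. \<phi> (f z)) (\<lambda>z. \<phi>' z * f1 z) (\<lambda>z. \<phi>' z * f2 z)"
  unfolding has_gradient_def
proof
  fix z
  have "((\<lambda>z. \<phi> (f z)) has_derivative (\<lambda>h. \<phi>' z * (f1 z * fst h + f2 z * snd h))) (at z)"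
    by (rule has_derivative_compose[OF has_gradientD[OF f] \<phi>[unfolded has_field_derivative_def]])
  then show "((\<lambda>z. \<phi> (f z)) has_derivative (\<lambda>h. \<phi>' z * f1 z * fst h + \<phi>' z * f2 z * snd h)) (at z)"
    by (rule has_derivative_eq_rhs) (auto simp: algebra_simps)
qed

lemma has_gradient_zero_imp_constant:
  assumes "has_gradient f (\<lambda>_. 0) (\<lambda>_. 0)"
  shows "f z = f z'"
  using DERIV_isconst_all[OF allI[OF has_gradient_line[OF assms, of z' "z - z'", simplified]], of 1 0]
  by simp

lemma has_gradient_linear: "has_gradient (\<lambda>z. a * fst z + b * snd z) (\<lambda>_. a) (\<lambda>_. b)"
  unfolding has_gradient_def by (auto intro!: derivative_eq_intros)

section \<open>Classes C^k and partial derivatives\<close>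

lemma C_k_has_gradient:
  assumes "C_k (Suc k) f"
  shows "has_gradient f (partial_x f) (partial_y f)"
  unfolding has_gradient_def
proof
  fix z :: "real \<times> real"
  obtain x y where z: "z = (x, y)" by (cases z)
  have "f differentiable (at z)" using assms unfolding C_k.simps by blast
  then obtain D where D: "(f has_derivative D) (at z)"
    unfolding differentiable_def by blast
  interpret D: bounded_linear D using D by (rule has_derivative_bounded_linear)
  have "((\<lambda>s. (s, y)) has_derivative (\<lambda>h. (h, 0))) (at x)"
    by (rule has_derivative_Pair) auto
  from has_derivative_compose[OF this D[unfolded z]]
  have "((\<lambda>s. f (s, y)) has_derivative (\<lambda>h. D (h, 0))) (at x)" .
  moreover have "(\<lambda>h. D (h, 0)) = (*) (D (1, 0))"
  proof
    show "D (h, 0) = D (1, 0) * h" for h using D.scaleR[of h "(1, 0)"] by (simp add: mult.commute)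
  qed
  ultimately have x: "partial_x f z = D (1, 0)"
    by (auto simp: partial_x_def z has_field_derivative_def intro!: DERIV_imp_deriv)
  have "((\<lambda>s. (x, s)) has_derivative (\<lambda>h. (0, h))) (at y)"
    by (rule has_derivative_Pair) auto
  from has_derivative_compose[OF this D[unfolded z]]
  have "((\<lambda>s. f (x, s)) has_derivative (\<lambda>h. D (0, h))) (at y)" .
  moreover have "(\<lambda>h. D (0, h)) = (*) (D (0, 1))"
  proof
    show "D (0, h) = D (0, 1) * h" for h using D.scaleR[of h "(0, 1)"] by (simp add: mult.commute)
  qed
  ultimately have y: "partial_y f z = D (0, 1)"
    by (auto simp: partial_y_def z has_field_derivative_def intro!: DERIV_imp_deriv)
  have "D h = partial_x f z * fst h + partial_y f z * snd h" for h
  proof -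
    have "h = fst h *\<^sub>R (1, 0) + snd h *\<^sub>R (0, 1)" by (simp add: prod_eq_iff)
    then have "D h = fst h *\<^sub>R D (1, 0) + snd h *\<^sub>R D (0, 1)" by (metis D.add D.scaleR)
    then show ?thesis by (simp add: x y)
  qed
  then have "D = (\<lambda>h. partial_x f z * fst h + partial_y f z * snd h)" ..
  with D show "(f has_derivative (\<lambda>h. partial_x f z * fst h + partial_y f z * snd h)) (at z)"
    by simp
qed

text \<open>An increment splits into an x-step and a y-step, and continuity of \<open>b\<close>
  controls the y-step uniformly near the point. This makes the potential in
  \<open>closed_form_has_potential\<close> Frechet differentiable.\<close>

lemma has_gradient_partialsI:
  fixes f :: "real \<times> real \<Rightarrow> real"
  assumes x: "\<And>x y. ((\<lambda>s. f (s, y)) has_real_derivative a (x, y)) (at x)"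
    and y: "\<And>x y. ((\<lambda>s. f (x, s)) has_real_derivative b (x, y)) (at y)"
    and b: "continuous_on UNIV b"
  shows "has_gradient f a b"
  unfolding has_gradient_def
proof
  fix z :: "real \<times> real"
  obtain x0 y0 where z: "z = (x0, y0)" by (cases z)
  have "((\<lambda>(x, y). f (x, y)) has_derivative
     (\<lambda>(tx, ty). a z * tx + blinfun_apply (blinfun_mult_right (b (x0, y0))) ty)) (at (x0, y0) within UNIV \<times> UNIV)"
  proof (rule has_derivative_partialsI)
    show "((\<lambda>x. f (x, y0)) has_derivative (*) (a z)) (at x0)"
      using x by (simp add: has_field_derivative_def z)
    show "((\<lambda>y. f (x, y)) has_derivative blinfun_apply (blinfun_mult_right (b (x, y)))) (at y)" for x y
      using y by (simp add: has_field_derivative_def)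
    have "continuous_on UNIV (\<lambda>z. blinfun_mult_right (b z))"
      using b by (intro continuous_intros)
    then show "continuous (at (x0, y0) within UNIV \<times> UNIV) (\<lambda>(x, y). blinfun_mult_right (b (x, y)))"
      by (simp add: continuous_on_eq_continuous_within case_prod_unfold)
  qed auto
  then show "(f has_derivative (\<lambda>h. a z * fst h + b z * snd h)) (at z)"
    by (simp add: z case_prod_unfold)
qed

lemma C_k_imp_continuous:
  assumes "C_k k f"
  shows "continuous_on UNIV f"
proof (cases k)
  case 0
  with assms show ?thesis by simp
next
  case (Suc n)
  with assms have "has_gradient f (partial_x f) (partial_y f)"
    by (metis C_k_has_gradient)
  then show ?thesis by (rule has_gradient_continuous)
qed

section \<open>Symmetry of mixed partial derivatives\<close>

text \<open>Two uses of the mean value theorem: in x for the difference of \<open>f\<close> at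
  heights \<open>y + h\<close> and \<open>y\<close>, then in y for \<open>a\<close> at abscissa
  \<open>\<xi>\<close>. The second difference of \<open>f\<close> is symmetric in the two
  variables.\<close>

lemma mixed_difference:
  fixes f :: "real \<times> real \<Rightarrow> real"
  assumes f: "\<And>x y. ((\<lambda>s. f (s, y)) has_real_derivative a (x, y)) (at x)"
    and a: "\<And>x y. ((\<lambda>s. a (x, s)) has_real_derivative c (x, y)) (at y)"
    and h: "h > 0"
  obtains \<xi> \<eta> where "x < \<xi>" "\<xi> < x + h" "y < \<eta>" "\<eta> < y + h"
    "f (x + h, y + h) - f (x, y + h) - f (x + h, y) + f (x, y) = h\<^sup>2 * c (\<xi>, \<eta>)"
proof -
  have "\<exists>\<xi>>x. \<xi> < x + h \<and>
      (f (x + h, y + h) - f (x + h, y)) - (f (x, y + h) - f (x, y)) =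
      (x + h - x) * (a (\<xi>, y + h) - a (\<xi>, y))"
    by (rule MVT2) (use h in \<open>auto intro!: derivative_intros f\<close>)
  then obtain \<xi> where \<xi>: "x < \<xi>" "\<xi> < x + h"
    "(f (x + h, y + h) - f (x + h, y)) - (f (x, y + h) - f (x, y)) = h * (a (\<xi>, y + h) - a (\<xi>, y))"
    by auto
  have "\<exists>\<eta>>y. \<eta> < y + h \<and> a (\<xi>, y + h) - a (\<xi>, y) = (y + h - y) * c (\<xi>, \<eta>)"
    by (rule MVT2) (use h in \<open>auto intro!: a\<close>)
  then obtain \<eta> where "y < \<eta>" "\<eta> < y + h" "a (\<xi>, y + h) - a (\<xi>, y) = h * c (\<xi>, \<eta>)"
    by auto
  with \<xi> show thesis
    by (intro that[of \<xi> \<eta>]) (auto simp: power2_eq_square algebra_simps)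
qed

lemma has_gradient_x:
  assumes "has_gradient f a b"
  shows "((\<lambda>s. f (s, y)) has_real_derivative a (x, y)) (at x within S)"
  using has_gradient_compose[OF assms, of "\<lambda>s. s" 1 x S "\<lambda>_. y" 0] by simp

lemma has_gradient_y:
  assumes "has_gradient f a b"
  shows "((\<lambda>s. f (x, s)) has_real_derivative b (x, y)) (at y within S)"
  using has_gradient_compose[OF assms, of "\<lambda>s. x" 0 y S "\<lambda>s. s" 1] by simp

text \<open>Schwarz's theorem: the second difference over a small square, computed in either order,
  gives a value of \<open>a2\<close> equal to a value of \<open>b1\<close> inside the square.
  Continuity carries the equality to the corner \<open>z\<close>.\<close>

lemma mixed_partials_eq:
  assumes f: "has_gradient f a b" and a: "has_gradient a a1 a2" and b: "has_gradient b b1 b2"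
    and cont: "continuous_on UNIV a2" "continuous_on UNIV b1"
  shows "a2 z = b1 z"
proof (rule ccontr)
  assume ne: "a2 z \<noteq> b1 z"
  obtain x y where z: "z = (x, y)" by (cases z)
  \<comment> \<open>Half the gap, so that the open \<open>e\<close>-balls around the two values are
    disjoint.\<close>
  define e where "e = dist (a2 z) (b1 z) / 2"
  have "e > 0" using ne by (simp add: e_def)
  obtain d1 where d1: "d1 > 0" "\<And>u. dist u z < d1 \<Longrightarrow> dist (a2 u) (a2 z) < e"
    using cont(1) \<open>e > 0\<close> unfolding continuous_on_iff by (metis UNIV_I)
  obtain d2 where d2: "d2 > 0" "\<And>u. dist u z < d2 \<Longrightarrow> dist (b1 u) (b1 z) < e"
    using cont(2) \<open>e > 0\<close> unfolding continuous_on_iff by (metis UNIV_I)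
  define h where "h = min d1 d2 / 2"
  have h: "h > 0" using d1 d2 by (simp add: h_def)
  have near: "dist (\<xi>, \<eta>) z < min d1 d2"
    if "x < \<xi>" "\<xi> < x + h" "y < \<eta>" "\<eta> < y + h" for \<xi> \<eta>
  proof -
    have "dist (\<xi>, \<eta>) z \<le> \<bar>\<xi> - x\<bar> + \<bar>\<eta> - y\<bar>"
      by (simp add: z dist_Pair_Pair dist_real_def sqrt_sum_squares_le_sum_abs)
    also have "\<dots> < 2 * h" using that by simp
    finally show ?thesis by (simp add: h_def)
  qed
  obtain \<xi> \<eta> where 1: "x < \<xi>" "\<xi> < x + h" "y < \<eta>" "\<eta> < y + h"
    "f (x + h, y + h) - f (x, y + h) - f (x + h, y) + f (x, y) = h\<^sup>2 * a2 (\<xi>, \<eta>)"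
    using mixed_difference[of f a a2 h x y] has_gradient_x[OF f] has_gradient_y[OF a] h by metis
  \<comment> \<open>\<open>mixed_difference\<close> with the two variables exchanged.\<close>
  obtain \<eta>' \<xi>' where 2: "y < \<eta>'" "\<eta>' < y + h" "x < \<xi>'" "\<xi>' < x + h"
    "f (x + h, y + h) - f (x + h, y) - f (x, y + h) + f (x, y) = h\<^sup>2 * b1 (\<xi>', \<eta>')"
    using mixed_difference[of "\<lambda>(y, x). f (x, y)" "\<lambda>(y, x). b (x, y)" "\<lambda>(y, x). b1 (x, y)" h y x]
      has_gradient_y[OF f] has_gradient_x[OF b] h by auto
  have "a2 (\<xi>, \<eta>) = b1 (\<xi>', \<eta>')" using 1(5) 2(5) h by (simp add: algebra_simps)
  moreover have "dist (a2 (\<xi>, \<eta>)) (a2 z) < e" "dist (b1 (\<xi>', \<eta>')) (b1 z) < e"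
    using near 1 2 d1 d2 by simp_all
  ultimately have "dist (a2 z) (b1 z) < 2 * e"
    by (metis dist_triangle_half_l mult_2 dist_commute mult.commute e_def field_sum_of_halves nonzero_mult_div_cancel_left zero_neq_numeral)
  then show False by (simp add: e_def)
qed

section \<open>The Poincare lemma on the plane\<close>

text \<open>The potential is the integral of \<open>P dx + Q dy\<close> along the segment from the
  origin. Closedness is encoded by \<open>P2\<close>, which is both the y-partial of
  \<open>P\<close> and the x-partial of \<open>Q\<close>.\<close>

lemma closed_form_has_potential:
  fixes P Q P1 P2 Q2 :: "real \<times> real \<Rightarrow> real"
  assumes P: "has_gradient P P1 P2" and Q: "has_gradient Q P2 Q2"
    and cont: "continuous_on UNIV P1" "continuous_on UNIV P2" "continuous_on UNIV Q2"
  obtains f where "has_gradient f P Q"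
proof
  define f where "f = (\<lambda>(x, y). integral {0..1} (\<lambda>t. x * P (t * x, t * y) + y * Q (t * x, t * y)))"
  note [continuous_intros] =
    has_gradient_continuous[OF P, of UNIV, THEN continuous_on_compose2]
    has_gradient_continuous[OF Q, of UNIV, THEN continuous_on_compose2]
    cont[THEN continuous_on_compose2]
  have integrable: "(\<lambda>t. x * P (t * x, t * y) + y * Q (t * x, t * y)) integrable_on {0..1}" for x y
    by (intro integrable_continuous_interval continuous_intros) auto
  have fx: "((\<lambda>s. f (s, y)) has_real_derivative P (x, y)) (at x)" for x y
  proof -
    \<comment> \<open>By closedness \<open>?D\<close> is the x-derivative of the integrand and also
      the t-derivative of \<open>t * P (t * x, t * y)\<close>, so its integral is
      \<open>P (x, y)\<close>.\<close>
    let ?D = "\<lambda>x t. P (t * x, t * y) + t * x * P1 (t * x, t * y) + t * y * P2 (t * x, t * y)"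
    have "((\<lambda>s. s * P (t * s, t * y) + y * Q (t * s, t * y)) has_real_derivative ?D x t) (at x)" for x t
    proof -
      have "((\<lambda>s. P (t * s, t * y)) has_real_derivative P1 (t * x, t * y) * t + P2 (t * x, t * y) * 0) (at x)"
        by (rule has_gradient_compose[OF P]) (auto intro!: derivative_eq_intros)
      moreover have "((\<lambda>s. Q (t * s, t * y)) has_real_derivative P2 (t * x, t * y) * t + Q2 (t * x, t * y) * 0) (at x)"
        by (rule has_gradient_compose[OF Q]) (auto intro!: derivative_eq_intros)
      ultimately show ?thesis
        by (auto intro!: derivative_eq_intros simp: algebra_simps)
    qed
    moreover have "continuous_on (UNIV \<times> cbox 0 1) (\<lambda>(x, t). ?D x t)"
      unfolding case_prod_unfold by (intro continuous_intros) auto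
    ultimately have "((\<lambda>s. integral (cbox 0 1) (\<lambda>t. s * P (t * s, t * y) + y * Q (t * s, t * y)))
       has_real_derivative integral (cbox 0 1) (?D x)) (at x within UNIV)"
      using integrable by (intro leibniz_rule_field_derivative) auto
    moreover have "((\<lambda>t. t * P (t * x, t * y)) has_real_derivative ?D x t) (at t within {0..1})" for t
    proof -
      have "((\<lambda>t. P (t * x, t * y)) has_real_derivative P1 (t * x, t * y) * x + P2 (t * x, t * y) * y)
          (at t within {0..1})"
        by (rule has_gradient_compose[OF P]) (auto intro!: derivative_eq_intros)
      from DERIV_mult[OF DERIV_ident this] show ?thesis by (simp add: algebra_simps)
    qed
    then have "(?D x has_integral (1 * P (1 * x, 1 * y) - 0 * P (0 * x, 0 * y))) {0..1}"
      by (intro fundamental_theorem_of_calculus)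
        (auto simp: has_real_derivative_iff_has_vector_derivative)
    ultimately show ?thesis by (simp add: integral_unique f_def)
  qed
  have fy: "((\<lambda>s. f (x, s)) has_real_derivative Q (x, y)) (at y)" for x y
  proof -
    let ?D = "\<lambda>y t. Q (t * x, t * y) + t * x * P2 (t * x, t * y) + t * y * Q2 (t * x, t * y)"
    have "((\<lambda>s. x * P (t * x, t * s) + s * Q (t * x, t * s)) has_real_derivative ?D y t) (at y)" for y t
    proof -
      have "((\<lambda>s. P (t * x, t * s)) has_real_derivative P1 (t * x, t * y) * 0 + P2 (t * x, t * y) * t) (at y)"
        by (rule has_gradient_compose[OF P]) (auto intro!: derivative_eq_intros)
      moreover have "((\<lambda>s. Q (t * x, t * s)) has_real_derivative P2 (t * x, t * y) * 0 + Q2 (t * x, t * y) * t) (at y)"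
        by (rule has_gradient_compose[OF Q]) (auto intro!: derivative_eq_intros)
      ultimately show ?thesis
        by (auto intro!: derivative_eq_intros simp: algebra_simps)
    qed
    moreover have "continuous_on (UNIV \<times> cbox 0 1) (\<lambda>(y, t). ?D y t)"
      unfolding case_prod_unfold by (intro continuous_intros) auto
    ultimately have "((\<lambda>s. integral (cbox 0 1) (\<lambda>t. x * P (t * x, t * s) + s * Q (t * x, t * s)))
       has_real_derivative integral (cbox 0 1) (?D y)) (at y within UNIV)"
      using integrable by (intro leibniz_rule_field_derivative) auto
    moreover have "((\<lambda>t. t * Q (t * x, t * y)) has_real_derivative ?D y t) (at t within {0..1})" for t
    proof -
      have "((\<lambda>t. Q (t * x, t * y)) has_real_derivative P2 (t * x, t * y) * x + Q2 (t * x, t * y) * y)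
          (at t within {0..1})"
        by (rule has_gradient_compose[OF Q]) (auto intro!: derivative_eq_intros)
      from DERIV_mult[OF DERIV_ident this] show ?thesis by (simp add: algebra_simps)
    qed
    then have "(?D y has_integral (1 * Q (1 * x, 1 * y) - 0 * Q (0 * x, 0 * y))) {0..1}"
      by (intro fundamental_theorem_of_calculus)
        (auto simp: has_real_derivative_iff_has_vector_derivative)
    ultimately show ?thesis by (simp add: integral_unique f_def)
  qed
  show "has_gradient f P Q"
    using fx fy by (rule has_gradient_partialsI) (rule has_gradient_continuous[OF Q])
qed

subsection \<open>Light-like points\<close>

text \<open>On \<open>[-1, 1]\<close> Taylor's formula puts \<open>f\<close> below a parabola with
  leading coefficient \<open>M / 2\<close>. Its minimum point \<open>- f1 0 / M\<close> lies in that
  interval, and non-negativity of \<open>f\<close> there is the claim.\<close>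

lemma nonneg_derivative_square_bound:
  fixes f f1 f2 :: "real \<Rightarrow> real"
  assumes f: "\<And>t. (f has_real_derivative f1 t) (at t)"
    and f1: "\<And>t. (f1 has_real_derivative f2 t) (at t)"
    and nonneg: "\<And>t. f t \<ge> 0"
    and f2: "\<And>t. \<bar>t\<bar> \<le> 1 \<Longrightarrow> \<bar>f2 t\<bar> \<le> M"
    and M: "\<bar>f1 0\<bar> \<le> M" "M > 0"
  shows "(f1 0)\<^sup>2 \<le> 2 * M * f 0"
proof -
  define x where "x = - f1 0 / M"
  have x: "\<bar>x\<bar> \<le> 1" using M by (simp add: x_def)
  define D where "D = (\<lambda>m::nat. if m = 0 then f else if m = 1 then f1 else f2)"
  have "\<exists>t. \<bar>t\<bar> \<le> \<bar>x\<bar> \<and> f x = (\<Sum>m<2. D m 0 / fact m * x ^ m) + D 2 t / fact 2 * x ^ 2"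
    by (rule Maclaurin_bi_le) (auto simp: D_def less_2_cases_iff f f1)
  then obtain t where t: "\<bar>t\<bar> \<le> \<bar>x\<bar>" "f x = f 0 + f1 0 * x + f2 t / 2 * x\<^sup>2"
    by (auto simp: D_def numeral_2_eq_2)
  have "f2 t / 2 * x\<^sup>2 \<le> M / 2 * x\<^sup>2"
    using f2[of t] t x by (intro mult_right_mono) auto
  then have "0 \<le> f 0 + f1 0 * x + M / 2 * x\<^sup>2"
    using t nonneg[of x] by simp
  also have "\<dots> = f 0 - (f1 0)\<^sup>2 / (2 * M)"
    using M by (simp add: x_def power2_eq_square field_simps)
  finally show ?thesis using M by (simp add: field_simps)
qed

text \<open>The integrating factor \<open>exp (- C * t)\<close> makes the product with
  \<open>f\<close> non-increasing.\<close>

lemma Gronwall_zero_right: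
  fixes f f' :: "real \<Rightarrow> real"
  assumes f: "\<And>t. (f has_real_derivative f' t) (at t)"
    and bound: "\<And>t. 0 \<le> t \<Longrightarrow> t < d \<Longrightarrow> f' t \<le> C * f t"
    and "f 0 = 0" "0 \<le> t" "t < d"
  shows "f t \<le> 0"
proof -
  have "f t * exp (- C * t) \<le> f 0 * exp (- C * 0)"
  proof (rule DERIV_nonpos_imp_nonincreasing[OF \<open>0 \<le> t\<close>])
    fix x assume x: "0 \<le> x" "x \<le> t"
    have "((\<lambda>t. f t * exp (- C * t)) has_real_derivative (f' x - C * f x) * exp (- C * x)) (at x)"
      by (auto intro!: derivative_eq_intros f simp: algebra_simps)
    moreover have "(f' x - C * f x) * exp (- C * x) \<le> 0"
      using bound[of x] x assms by (intro mult_nonpos_nonneg) auto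
    ultimately show "\<exists>y. ((\<lambda>t. f t * exp (- C * t)) has_real_derivative y) (at x) \<and> y \<le> 0"
      by blast
  qed
  then show ?thesis by (simp add: \<open>f 0 = 0\<close> mult_le_0_iff)
qed

text \<open>The one-sided version is applied to \<open>f\<close> and to its reflection
  \<open>f (- t)\<close>, which satisfies the same differential inequality.\<close>

lemma Gronwall_zero:
  fixes f f' :: "real \<Rightarrow> real"
  assumes f: "\<And>t. (f has_real_derivative f' t) (at t)"
    and bound: "\<And>t. \<bar>t\<bar> < d \<Longrightarrow> \<bar>f' t\<bar> \<le> C * f t"
    and nonneg: "\<And>t. f t \<ge> 0"
    and "f 0 = 0" "\<bar>t\<bar> < d"
  shows "f t = 0"
proof -
  have "f t \<le> 0" if "t \<ge> 0"
    by (rule Gronwall_zero_right[OF f, where d = d and C = C])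
      (use bound assms that in \<open>auto simp: abs_le_iff\<close>)
  moreover have "f t \<le> 0" if "t \<le> 0"
  proof -
    have "((\<lambda>t. f (- t)) has_real_derivative - f' (- t)) (at t)" for t
      using DERIV_chain2[OF f, of uminus "- 1" t UNIV] by (simp add: DERIV_minus[OF DERIV_ident])
    moreover have "- f' (- t) \<le> C * f (- t)" if "0 \<le> t" "t < d" for t
      using bound[of "- t"] that by (auto simp: abs_le_iff)
    ultimately have "f (- (- t)) \<le> 0"
      using assms that by (intro Gronwall_zero_right[where f = "\<lambda>t. f (- t)" and d = d and C = C and f' = "\<lambda>t. - f' (- t)"]) auto
    then show ?thesis by simp
  qed
  ultimately show ?thesis using nonneg[of t] by linarith
qed

text \<open>Meant for directional derivatives: \<open>x\<close> and \<open>y\<close> are, up to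
  sign, components of a unit vector, and each nested combination doubles the bound.\<close>

lemma abs_combination_le:
  fixes x y f g :: real
  assumes "\<bar>x\<bar> \<le> 1" "\<bar>y\<bar> \<le> 1" "\<bar>f\<bar> \<le> K" "\<bar>g\<bar> \<le> L"
  shows "\<bar>x * f + y * g\<bar> \<le> K + L"
proof -
  have "\<bar>x\<bar> * \<bar>f\<bar> \<le> 1 * K" "\<bar>y\<bar> * \<bar>g\<bar> \<le> 1 * L"
    using assms by (intro mult_mono; simp)+
  then have "\<bar>x * f\<bar> + \<bar>y * g\<bar> \<le> K + L" by (simp add: abs_mult)
  then show ?thesis by (rule order_trans[OF abs_triangle_ineq])
qed

section \<open>Zero mean curvature graphs without time-like points\<close>

text \<open>\<open>p\<close>, \<open>q\<close> are the first partials of \<open>\<psi>\<close>,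
  \<open>r\<close>, \<open>s\<close>, \<open>t\<close> the second ones, and the indexed functions
  the third ones. The shared \<open>s\<close> encodes symmetry of the mixed partials.\<close>

locale zmc_graph =
  fixes \<psi> p q r s t r1 r2 s1 s2 t1 t2 :: "real \<times> real \<Rightarrow> real"
  assumes \<psi>: "has_gradient \<psi> p q"
    and p: "has_gradient p r s" and q: "has_gradient q s t"
    and r: "has_gradient r r1 r2" and s: "has_gradient s s1 s2" and t: "has_gradient t t1 t2"
    and cont: "continuous_on UNIV r1" "continuous_on UNIV r2" "continuous_on UNIV s1"
      "continuous_on UNIV s2" "continuous_on UNIV t1" "continuous_on UNIV t2"
    and zmc: "(1 - (q z)\<^sup>2) * r z + 2 * p z * q z * s z + (1 - (p z)\<^sup>2) * t z = 0"
    and gradient_le_1: "(p z)\<^sup>2 + (q z)\<^sup>2 \<le> 1"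
begin

lemma derivatives_bounded:
  assumes "compact K"
  shows "\<exists>M>0. \<forall>f\<in>{r, s, t, r1, r2, s1, s2, t1, t2}. \<forall>z\<in>K. \<bar>f z\<bar> \<le> M"
proof -
  let ?D = "{r, s, t, r1, r2, s1, s2, t1, t2}"
  have "continuous_on K f" if "f \<in> ?D" for f
    using that r s t cont[THEN continuous_on_subset, of K] by (auto intro: has_gradient_continuous)
  then have "bounded (f ` K)" if "f \<in> ?D" for f
    using that assms compact_continuous_image compact_imp_bounded by metis
  then have "bounded (\<Union>f\<in>?D. f ` K)"
    by (intro bounded_UN ballI) simp
  then obtain M where M: "M > 0" "\<forall>x\<in>(\<Union>f\<in>?D. f ` K). norm x \<le> M"
    unfolding bounded_pos by metis
  show ?thesis
  proof (intro exI[of _ M] conjI ballI M(1))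
    fix f z assume "f \<in> ?D" "z \<in> K"
    then have "f z \<in> (\<Union>f\<in>?D. f ` K)" by blast
    with M(2) have "norm (f z) \<le> M" by (rule bspec)
    then show "\<bar>f z\<bar> \<le> M" by simp
  qed
qed

lemma light_like_locally_constant:
  assumes light: "(p z0)\<^sup>2 + (q z0)\<^sup>2 = 1"
  obtains d where "d > 0" "\<And>\<tau>. \<bar>\<tau>\<bar> < d \<Longrightarrow>
    p (z0 + \<tau> *\<^sub>R (p z0, q z0)) = p z0 \<and> q (z0 + \<tau> *\<^sub>R (p z0, q z0)) = q z0"
proof -
  \<comment> \<open>\<open>w\<close> is non-negative and vanishes at \<open>z0\<close>, and the equation bounds its derivative along
    \<open>(a, b)\<close> by \<open>w\<close> plus the square of its normal derivative, which is \<open>O(w)\<close> since \<open>w \<ge> 0\<close>.\<close>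
  define a b where "a = p z0" and "b = q z0"
  define w where "w = (\<lambda>z. 1 - (a * p z + b * q z))"
  have ab: "a\<^sup>2 + b\<^sup>2 = 1" using light by (simp add: a_def b_def)
  have ab1: "\<bar>a\<bar> \<le> 1" "\<bar>b\<bar> \<le> 1" 
    using ab zero_le_power2[of a] zero_le_power2[of b] unfolding abs_square_le_1[symmetric] by linarith+
  \<comment> \<open>The two squared terms are the components of the gradient in the orthonormal
    frame \<open>(a, b)\<close>, \<open>(- b, a)\<close>.\<close>
  have rot: "(a * p z + b * q z)\<^sup>2 + (a * q z - b * p z)\<^sup>2 \<le> 1" for z
  proof -
    have "(a * p z + b * q z)\<^sup>2 + (a * q z - b * p z)\<^sup>2 = (a\<^sup>2 + b\<^sup>2) * ((p z)\<^sup>2 + (q z)\<^sup>2)"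
      by (simp add: power2_eq_square algebra_simps)
    then show ?thesis using gradient_le_1 ab by simp
  qed
  have abs1: "\<bar>a * p z + b * q z\<bar> \<le> 1" for z
    using rot[of z] zero_le_power2[of "a * q z - b * p z"] unfolding abs_square_le_1[symmetric] by linarith
  have w_nonneg: "w z \<ge> 0" for z
    using abs1[of z] by (simp add: w_def)
  note gp = has_gradient_linear_combination[OF p q, of a b]
  have w_line: "((\<lambda>\<tau>. w (z + \<tau> *\<^sub>R v)) has_real_derivative
     - (fst v * (a * r (z + \<tau> *\<^sub>R v) + b * s (z + \<tau> *\<^sub>R v)) + snd v * (a * s (z + \<tau> *\<^sub>R v) + b * t (z + \<tau> *\<^sub>R v)))) (at \<tau>)"
    for z v \<tau>
    using DERIV_diff[OF DERIV_const has_gradient_line[OF gp], of 1] by (simp add: w_def)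
  \<comment> \<open>Radius 2 leaves room for unit steps starting in the unit ball around
    \<open>z0\<close>.\<close>
  obtain M where "M > 0"
    and "\<forall>f\<in>{r, s, t, r1, r2, s1, s2, t1, t2}. \<forall>z\<in>cball z0 2. \<bar>f z\<bar> \<le> M"
    using derivatives_bounded[OF compact_cball[of z0 2]] by metis
  note M = this(1) this(2)[rule_format]
  have norm_n: "norm (- b, a) = 1" "norm (a, b) = 1"
    using ab by (simp_all add: norm_Pair add.commute)
  \<comment> \<open>\<open>nonneg_derivative_square_bound\<close> on the normal line through
    \<open>z\<close>. Three nested combinations in the second derivative of \<open>w\<close> turn
    \<open>M\<close> into \<open>8 * M\<close>.\<close>
  have normal: "(- b * (a * r z + b * s z) + a * (a * s z + b * t z))\<^sup>2 \<le> 2 * (8 * M) * w z"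
    if z: "z \<in> cball z0 1" for z
  proof -
    let ?z = "\<lambda>\<tau>. z + \<tau> *\<^sub>R (- b, a)"
    let ?f1 = "\<lambda>\<tau>. - (- b * (a * r (?z \<tau>) + b * s (?z \<tau>)) + a * (a * s (?z \<tau>) + b * t (?z \<tau>)))"
    let ?f2 = "\<lambda>\<tau>. - (- b * (- b * (a * r1 (?z \<tau>) + b * s1 (?z \<tau>)) + a * (a * r2 (?z \<tau>) + b * s2 (?z \<tau>)))
        + a * (- b * (a * s1 (?z \<tau>) + b * t1 (?z \<tau>)) + a * (a * s2 (?z \<tau>) + b * t2 (?z \<tau>))))"
    have "(?f1 0)\<^sup>2 \<le> 2 * (8 * M) * w (?z 0)"
    proof (rule nonneg_derivative_square_bound)
      show "((\<lambda>\<tau>. w (?z \<tau>)) has_real_derivative ?f1 \<tau>) (at \<tau>)" for \<tau>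
        using w_line[of z "(- b, a)"] by simp
      show "(?f1 has_real_derivative ?f2 \<tau>) (at \<tau>)" for \<tau>
        using DERIV_minus[OF DERIV_add[OF
          DERIV_cmult[OF has_gradient_line[OF has_gradient_linear_combination[OF r s, of a b], of z "(- b, a)"], of "- b"]
          DERIV_cmult[OF has_gradient_line[OF has_gradient_linear_combination[OF s t, of a b], of z "(- b, a)"], of a]]]
        by simp
      show "w (?z \<tau>) \<ge> 0" for \<tau> by (rule w_nonneg)
      have in2: "?z \<tau> \<in> cball z0 2" if "\<bar>\<tau>\<bar> \<le> 1" for \<tau>
      proof -
        have "dist z0 (?z \<tau>) \<le> dist z0 z + norm (\<tau> *\<^sub>R (- b, a))"
          by (metis dist_triangle dist_norm add_diff_cancel_left' dist_commute)
        also have "\<dots> \<le> 1 + 1"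
          using z that by (intro add_mono) (simp, simp only: norm_scaleR norm_n mult_1_right)
        finally show ?thesis by simp
      qed
      have n1: "\<bar>- b\<bar> \<le> 1" using ab1 by simp
      show "\<bar>?f2 \<tau>\<bar> \<le> 8 * M" if "\<bar>\<tau>\<bar> \<le> 1" for \<tau>
      proof -
        have "\<bar>?f2 \<tau>\<bar> \<le> ((M + M) + (M + M)) + ((M + M) + (M + M))"
          unfolding abs_minus_cancel
          by (intro abs_combination_le n1 ab1 M(2) in2 that) simp_all
        then show ?thesis by simp
      qed
      have "\<bar>?f1 0\<bar> \<le> (M + M) + (M + M)"
        unfolding abs_minus_cancel
        by (intro abs_combination_le n1 ab1 M(2) in2) simp_all
      with M(1) show "\<bar>?f1 0\<bar> \<le> 8 * M" by simp
    qed (use M in auto)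
    then show ?thesis by (simp only: scaleR_zero_left add_0_right power2_minus)
  qed
  let ?z = "\<lambda>\<tau>. z0 + \<tau> *\<^sub>R (a, b)"
  let ?f' = "\<lambda>\<tau>. - (a * (a * r (?z \<tau>) + b * s (?z \<tau>)) + b * (a * s (?z \<tau>) + b * t (?z \<tau>)))"
  have f: "((\<lambda>\<tau>. w (?z \<tau>)) has_real_derivative ?f' \<tau>) (at \<tau>)" for \<tau>
    using w_line[of z0 "(a, b)"] by simp
  have w0: "w (?z 0) = 0" using ab by (simp add: w_def a_def b_def power2_eq_square zero_prod_def[symmetric])
  have "isCont (\<lambda>\<tau>. w (?z \<tau>)) 0" using f DERIV_isCont by blast
  \<comment> \<open>The threshold 1/4 will give
    \<open>\<beta>\<^sup>2 \<le> 2 * w \<le> 1/2\<close>, which keeps the coefficient of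
    \<open>vv\<close> in the rotated equation at least 1/2.\<close>
  then have "\<exists>d>0. \<forall>\<tau>. dist \<tau> 0 < d \<longrightarrow> dist (w (?z \<tau>)) (w (?z 0)) < 1/4"
    unfolding continuous_at_eps_delta by (rule allE[of _ "1/4"]) (erule mp, simp)
  then obtain d0 where d0: "d0 > 0" "\<And>\<tau>. \<bar>\<tau>\<bar> < d0 \<Longrightarrow> \<bar>w (?z \<tau>)\<bar> < 1/4"
    unfolding w0 dist_real_def diff_0_right by metis
  have bound: "\<bar>?f' \<tau>\<bar> \<le> (4 + 48 * M) * w (?z \<tau>)" if "\<bar>\<tau>\<bar> < min 1 d0" for \<tau>
  proof -
    let ?z = "?z \<tau>"
    \<comment> \<open>Gradient components along \<open>(a, b)\<close> and \<open>(- b, a)\<close>;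
      \<open>vv\<close>, \<open>vn\<close>, \<open>nn\<close> are the second derivatives of
      \<open>\<psi>\<close> in this frame, and the derivative of \<open>w\<close> along the line is
      \<open>- vv\<close>.\<close>
    define \<alpha> \<beta> where "\<alpha> = a * p ?z + b * q ?z" and "\<beta> = a * q ?z - b * p ?z"
    define vv where "vv = a * (a * r ?z + b * s ?z) + b * (a * s ?z + b * t ?z)"
    define vn where "vn = - b * (a * r ?z + b * s ?z) + a * (a * s ?z + b * t ?z)"
    define nn where "nn = (b * r ?z - a * s ?z) * b + (a * t ?z - b * s ?z) * a"
    have "dist z0 ?z = norm (\<tau> *\<^sub>R (a, b))"
      by (metis add_diff_cancel_left' dist_commute dist_norm)
    then have z: "?z \<in> cball z0 1"
      unfolding mem_cball norm_scaleR norm_n using that by simp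
    have 1: "vn\<^sup>2 \<le> 16 * M * w ?z" using normal[OF z] by (simp add: vn_def)
    \<comment> \<open>the zero mean curvature equation in the rotated frame \<open>(a, b)\<close>, \<open>(- b, a)\<close>\<close>
    have 2: "(1 - \<beta>\<^sup>2) * vv + 2 * \<alpha> * \<beta> * vn + (1 - \<alpha>\<^sup>2) * nn = 0"
      using zmc[of ?z] ab unfolding \<alpha>_def \<beta>_def vv_def vn_def nn_def by algebra
    have wz: "\<alpha> = 1 - w ?z" by (simp add: \<alpha>_def w_def)
    have 3: "1 - \<alpha>\<^sup>2 \<le> 2 * w ?z" "\<beta>\<^sup>2 \<le> 1 - \<alpha>\<^sup>2"
      using rot[of ?z, folded \<alpha>_def \<beta>_def] by (simp_all add: wz power2_diff)
    have 4: "\<bar>\<alpha>\<bar> \<le> 1" using abs1 by (simp add: \<alpha>_def)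
    have 5: "\<bar>nn\<bar> \<le> (M + M) + (M + M)"
    proof -
      have z2: "?z \<in> cball z0 2" using z by simp
      have neg: "\<bar>- a\<bar> \<le> 1" "\<bar>- b\<bar> \<le> 1" using ab1 by simp_all
      have "\<bar>b * (b * r ?z + - a * s ?z) + a * (- b * s ?z + a * t ?z)\<bar> \<le> (M + M) + (M + M)"
        by (intro abs_combination_le ab1 neg M(2) z2) simp_all
      then show ?thesis by (simp add: nn_def algebra_simps)
    qed
    have 6: "\<beta>\<^sup>2 \<le> 1/2" using 3 d0(2)[of \<tau>] that by auto
    \<comment> \<open>The equation is solved for \<open>vv\<close>. Half of
      \<open>\<bar>vv\<bar>\<close> is at most \<open>\<beta>\<^sup>2 + vn\<^sup>2\<close> plus the
      \<open>nn\<close> term, hence at most \<open>2 + 16 * M + 8 * M\<close> times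
      \<open>w\<close>; doubling gives the constant.\<close>
    have "\<bar>vv\<bar> * (1/2) \<le> \<bar>vv\<bar> * (1 - \<beta>\<^sup>2)" using 6 by (intro mult_left_mono) auto
    also have "\<dots> = \<bar>(1 - \<beta>\<^sup>2) * vv\<bar>" using 6 by (simp add: abs_mult)
    also have "\<dots> \<le> \<bar>2 * \<alpha> * \<beta> * vn\<bar> + \<bar>(1 - \<alpha>\<^sup>2) * nn\<bar>" using 2 by linarith
    also have "\<bar>2 * \<alpha> * \<beta> * vn\<bar> \<le> 2 * \<bar>\<beta> * vn\<bar>"
      using 4 mult_right_mono[of "\<bar>\<alpha>\<bar>" 1 "2 * \<bar>\<beta> * vn\<bar>"] by (simp add: abs_mult mult_ac)
    also have "2 * \<bar>\<beta> * vn\<bar> \<le> \<beta>\<^sup>2 + vn\<^sup>2"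
      using sum_squares_bound[of "\<bar>\<beta>\<bar>" "\<bar>vn\<bar>"] by (simp add: abs_mult)
    also have "\<bar>(1 - \<alpha>\<^sup>2) * nn\<bar> \<le> (2 * w ?z) * (M + M + (M + M))"
      unfolding abs_mult using 3 5 M w_nonneg[of ?z] zero_le_power2[of \<beta>] by (intro mult_mono) linarith+
    finally have "\<bar>vv\<bar> \<le> (4 + 48 * M) * w ?z" using 1 3 by (simp add: algebra_simps)
    then show ?thesis by (simp add: vv_def abs_minus_commute)
  qed
  show thesis
  proof
    show "min 1 d0 > 0" using d0 by simp
    fix \<tau> assume \<tau>: "\<bar>\<tau>\<bar> < min 1 d0"
    have "w (?z \<tau>) = 0"
      by (rule Gronwall_zero[OF f bound w_nonneg w0 \<tau>])
    \<comment> \<open>Equality case of Cauchy-Schwarz: the left side expands to at most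
      \<open>2 * w (?z \<tau>)\<close>.\<close>
    then have "(p (?z \<tau>) - a)\<^sup>2 + (q (?z \<tau>) - b)\<^sup>2 \<le> 0"
      using gradient_le_1[of "?z \<tau>"] ab by (simp add: w_def power2_eq_square algebra_simps)
    then show "p (z0 + \<tau> *\<^sub>R (p z0, q z0)) = p z0 \<and> q (z0 + \<tau> *\<^sub>R (p z0, q z0)) = q z0"
      by (simp add: a_def b_def sum_power2_le_zero_iff)
  qed
qed

text \<open>The parameters at which the gradient equals that at \<open>z0\<close> form a closed set,
  which is open by \<open>light_like_locally_constant\<close> and hence all of the line. There
  \<open>\<psi>\<close> has slope \<open>(p z0)\<^sup>2 + (q z0)\<^sup>2 = 1\<close>.\<close>

lemma light_like_line:
  assumes light: "(p z0)\<^sup>2 + (q z0)\<^sup>2 = 1"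
  shows "\<psi> (z0 + \<tau> *\<^sub>R (p z0, q z0)) = \<psi> z0 + \<tau>"
proof -
  let ?v = "(p z0, q z0)"
  define S where "S = {\<tau>. p (z0 + \<tau> *\<^sub>R ?v) = p z0 \<and> q (z0 + \<tau> *\<^sub>R ?v) = q z0}"
  have "closed S"
    unfolding S_def
    using has_gradient_continuous[OF p, of UNIV] has_gradient_continuous[OF q, of UNIV]
    by (intro closed_Collect_conj closed_Collect_eq continuous_intros)
      (auto elim!: continuous_on_compose2 intro!: continuous_intros)
  moreover have "open S"
    unfolding open_dist
  proof
    fix \<sigma> assume "\<sigma> \<in> S"
    then have *: "p (z0 + \<sigma> *\<^sub>R ?v) = p z0" "q (z0 + \<sigma> *\<^sub>R ?v) = q z0" by (auto simp: S_def)
    obtain d where d: "d > 0" "\<And>\<tau>. \<bar>\<tau>\<bar> < d \<Longrightarrow>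
        p (z0 + \<sigma> *\<^sub>R ?v + \<tau> *\<^sub>R ?v) = p z0 \<and> q (z0 + \<sigma> *\<^sub>R ?v + \<tau> *\<^sub>R ?v) = q z0"
      using light_like_locally_constant[of "z0 + \<sigma> *\<^sub>R ?v"] light unfolding * by blast
    have "\<tau> \<in> S" if "dist \<tau> \<sigma> < d" for \<tau>
    proof -
      have eq: "z0 + \<sigma> *\<^sub>R ?v + (\<tau> - \<sigma>) *\<^sub>R ?v = z0 + \<tau> *\<^sub>R ?v"
        by (simp only: scaleR_left_diff_distrib) simp
      show ?thesis
        using d(2)[of "\<tau> - \<sigma>", unfolded eq] that by (simp add: S_def dist_real_def)
    qed
    with d show "\<exists>e>0. \<forall>y. dist y \<sigma> < e \<longrightarrow> y \<in> S" by blast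
  qed
  moreover have "0 \<in> S" by (simp add: S_def zero_prod_def[symmetric])
  ultimately have "S = UNIV" using clopen[of S] by blast
  then have S: "p (z0 + \<tau> *\<^sub>R ?v) = p z0" "q (z0 + \<tau> *\<^sub>R ?v) = q z0" for \<tau>
    by (auto simp: S_def)
  have "((\<lambda>\<tau>. \<psi> (z0 + \<tau> *\<^sub>R ?v) - \<tau>) has_real_derivative 0) (at \<tau>)" for \<tau>
    using DERIV_diff[OF has_gradient_line[OF \<psi>, of z0 ?v \<tau>] DERIV_ident] light
    unfolding S by (simp add: power2_eq_square)
  from DERIV_isconst_all[OF allI[OF this], of \<tau> 0] show ?thesis
    by (simp add: zero_prod_def[symmetric])
qed

text \<open>Mean value theorem on the segment, followed by Cauchy-Schwarz.\<close>

lemma lipschitz: "(\<psi> z - \<psi> z')\<^sup>2 \<le> (norm (z - z'))\<^sup>2"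
proof -
  define h where "h = z - z'"
  have "\<exists>\<xi>>0. \<xi> < 1 \<and> \<psi> (z' + 1 *\<^sub>R h) - \<psi> (z' + 0 *\<^sub>R h) =
      (1 - 0) * (fst h * p (z' + \<xi> *\<^sub>R h) + snd h * q (z' + \<xi> *\<^sub>R h))"
    by (rule MVT2) (auto intro: has_gradient_line[OF \<psi>])
  then obtain \<xi> where "\<psi> z - \<psi> z' = p (z' + \<xi> *\<^sub>R h) * fst h + q (z' + \<xi> *\<^sub>R h) * snd h"
    by (auto simp: h_def mult.commute)
  moreover have "(P * x + Q * y)\<^sup>2 \<le> (P\<^sup>2 + Q\<^sup>2) * (x\<^sup>2 + y\<^sup>2)" for P Q x y :: real
    using zero_le_power2[of "P * y - Q * x"] by (simp add: power2_eq_square algebra_simps)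
  ultimately have "(\<psi> z - \<psi> z')\<^sup>2 \<le> ((p (z' + \<xi> *\<^sub>R h))\<^sup>2 + (q (z' + \<xi> *\<^sub>R h))\<^sup>2) * ((fst h)\<^sup>2 + (snd h)\<^sup>2)"
    by simp
  also have "\<dots> \<le> 1 * ((fst h)\<^sup>2 + (snd h)\<^sup>2)"
    using gradient_le_1 by (intro mult_right_mono) auto
  finally show ?thesis by (simp add: h_def norm_prod_def)
qed

text \<open>When \<open>z\<close> is compared with the point at parameter \<open>\<tau>\<close> of
  the light-like line, the terms in \<open>\<tau>\<^sup>2\<close> cancel. A bound linear in
  \<open>\<tau>\<close> remains, valid for all real \<open>\<tau>\<close>, so its slope
  vanishes.\<close>

lemma light_like_imp_affine:
  assumes light: "(p z0)\<^sup>2 + (q z0)\<^sup>2 = 1"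
  shows "\<psi> z = \<psi> z0 + p z0 * (fst z - fst z0) + q z0 * (snd z - snd z0)"
proof -
  define x y c where "x = fst z - fst z0" and "y = snd z - snd z0" and "c = \<psi> z - \<psi> z0"
  have ineq: "c\<^sup>2 - x\<^sup>2 - y\<^sup>2 \<le> 2 * \<tau> * (c - (p z0 * x + q z0 * y))" for \<tau>
  proof -
    have "(c - \<tau>)\<^sup>2 \<le> (norm (z - (z0 + \<tau> *\<^sub>R (p z0, q z0))))\<^sup>2"
      using lipschitz[of z "z0 + \<tau> *\<^sub>R (p z0, q z0)"] light_like_line[OF light, of \<tau>]
      by (simp add: c_def algebra_simps)
    also have "\<dots> = (x - \<tau> * p z0)\<^sup>2 + (y - \<tau> * q z0)\<^sup>2"
      by (simp add: norm_prod_def x_def y_def algebra_simps)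
    also have "\<dots> = x\<^sup>2 + y\<^sup>2 - 2 * \<tau> * (p z0 * x + q z0 * y) + \<tau>\<^sup>2 * ((p z0)\<^sup>2 + (q z0)\<^sup>2)"
      by (simp add: power2_eq_square algebra_simps)
    finally show ?thesis unfolding light by (simp add: power2_eq_square algebra_simps)
  qed
  have "c = p z0 * x + q z0 * y"
  proof (rule ccontr)
    assume ne: "c \<noteq> p z0 * x + q z0 * y"
    define k e where "k = c\<^sup>2 - x\<^sup>2 - y\<^sup>2" and "e = c - (p z0 * x + q z0 * y)"
    have "e \<noteq> 0" using ne by (simp add: e_def)
    \<comment> \<open>This parameter makes the right side of \<open>ineq\<close> equal to
      \<open>k - 1\<close>.\<close>
    then have "k \<le> k - 1"
      using ineq[of "(k - 1) / (2 * e)", folded k_def e_def] by simp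
    then show False by simp
  qed
  then show ?thesis by (simp add: c_def x_def y_def)
qed

end

subsection \<open>Functions with Hessian determinant 1\<close>

text \<open>The range is open by invariance of domain and closed because expansion pulls Cauchy
  sequences back; connectedness concludes.\<close>

lemma expanding_imp_surj:
  fixes f :: "'a::euclidean_space \<Rightarrow> 'b::euclidean_space"
  assumes cont: "continuous_on UNIV f" and expand: "\<And>x y. norm (x - y) \<le> norm (f x - f y)"
    and dim: "DIM('b) \<le> DIM('a)"
  shows "surj f"
proof -
  have inj: "inj f"
  proof (rule injI)
    fix x y assume "f x = f y"
    then show "x = y" using expand[of x y] by simp
  qed
  have "open (range f)"
    by (rule invariance_of_domain_gen[OF open_UNIV cont inj dim])
  moreover have "closed (range f)"
    unfolding closed_sequential_limits
  proof (intro allI impI, elim conjE)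
    fix y l assume "\<forall>n. y n \<in> range f" and lim: "y \<longlonglongrightarrow> l"
    then have "\<forall>n. \<exists>x. y n = f x" by blast
    then obtain x where "\<forall>n. y n = f (x n)" by metis
    then have y: "y = (\<lambda>n. f (x n))" by blast
    have "Cauchy (\<lambda>n. f (x n))" using lim LIMSEQ_imp_Cauchy unfolding y by blast
    then have "Cauchy x"
      unfolding Cauchy_def dist_norm using expand by (meson order_le_less_trans)
    then obtain a where "x \<longlonglongrightarrow> a"
      using Cauchy_convergent convergentD by blast
    moreover have "isCont f a" using cont by (simp add: continuous_on_eq_continuous_at)
    ultimately have "(\<lambda>n. f (x n)) \<longlonglongrightarrow> f a" by (rule isCont_tendsto_compose[rotated])
    then show "l \<in> range f" using lim LIMSEQ_unique unfolding y by blast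
  qed
  ultimately show ?thesis using clopen[of "range f"] by blast
qed

text \<open>Liouville's theorem for polynomial growth of degree 1 makes \<open>f\<close>
  affine.\<close>

lemma entire_linear_growth_imp_deriv_constant:
  assumes "f holomorphic_on UNIV" and growth: "\<And>z. norm (f z - f 0) \<le> norm z"
  shows "deriv f z = deriv f 0"
proof -
  have bound: "norm (f z) \<le> (norm (f 0) + 1) * norm z ^ 1" if "1 \<le> norm z" for z
  proof -
    have "norm (f z) \<le> norm (f 0) + norm z"
      using growth[of z] norm_triangle_sub[of "f z" "f 0"] by linarith
    also have "\<dots> \<le> norm (f 0) * norm z + norm z"
      using that mult_left_mono[of 1 "norm z" "norm (f 0)"] by simp
    finally show ?thesis by (simp add: algebra_simps)
  qed
  have eq: "f 0 + deriv f 0 * \<xi> = f \<xi>" for \<xi>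
    using Liouville_polynomial[OF assms(1) bound, of 1 \<xi>] by simp
  have "((\<lambda>\<xi>. f 0 + deriv f 0 * \<xi>) has_field_derivative deriv f 0) (at z)"
    by (auto intro!: derivative_eq_intros)
  then show ?thesis
    unfolding eq by (rule DERIV_imp_deriv)
qed

text \<open>The inverse of \<open>T\<close> is 1-Lipschitz, so an error small relative to
  \<open>y - x\<close> is also small relative to \<open>T y - T x\<close>. That \<open>h\<close> has
  derivative \<open>c * T'\<close> is the Cauchy-Riemann condition in the coordinate
  \<open>T\<close>.\<close>

lemma complex_derivative_wrt_expanding:
  fixes T h :: "'a::euclidean_space \<Rightarrow> complex"
  assumes expand: "\<And>x y. norm (x - y) \<le> norm (T x - T y)" and surj: "surj T"
    and T: "(T has_derivative T') (at x)" and h: "(h has_derivative (\<lambda>k. c * T' k)) (at x)"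
  shows "((\<lambda>\<zeta>. h (inv T \<zeta>)) has_field_derivative c) (at (T x))"
  unfolding has_field_derivative_def has_derivative_at_alt
proof (intro conjI allI impI)
  show "bounded_linear ((*) c)" by (rule bounded_linear_mult_right)
  fix e :: real assume "e > 0"
  have inv: "inv T (T x) = x"
    using expand by (intro inv_f_f injI) (metis eq_iff_diff_eq_0 norm_le_zero_iff norm_zero)
  have "((\<lambda>y. h y - c * T y) has_derivative (\<lambda>k. c * T' k - c * T' k)) (at x)"
    by (intro has_derivative_diff h has_derivative_mult_right T)
  then obtain d where d: "d > 0" "\<And>y. norm (y - x) < d \<Longrightarrow>
      norm (h y - c * T y - (h x - c * T x)) \<le> e * norm (y - x)"
    unfolding has_derivative_at_alt using \<open>e > 0\<close> by auto
  show "\<exists>d>0. \<forall>\<zeta>. norm (\<zeta> - T x) < d \<longrightarrow>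
      norm (h (inv T \<zeta>) - h (inv T (T x)) - c * (\<zeta> - T x)) \<le> e * norm (\<zeta> - T x)"
  proof (intro exI[of _ d] conjI d(1) allI impI)
    fix \<zeta> assume *: "norm (\<zeta> - T x) < d"
    define y where "y = inv T \<zeta>"
    have y: "\<zeta> = T y" using surj by (simp add: y_def surj_f_inv_f)
    have "norm (h y - h x - c * (T y - T x)) = norm (h y - c * T y - (h x - c * T x))"
      by (simp add: algebra_simps)
    also have "\<dots> \<le> e * norm (y - x)"
      using d(2) expand[of y x] * by (simp add: y)
    also have "\<dots> \<le> e * norm (T y - T x)"
      using expand \<open>e > 0\<close> by simp
    finally show "norm (h (inv T \<zeta>) - h (inv T (T x)) - c * (\<zeta> - T x)) \<le> e * norm (\<zeta> - T x)"
      unfolding inv y_def[symmetric] by (simp add: y)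
  qed
qed

section \<open>Monotone gradient maps and the Beltrami coefficient\<close>

text \<open>The mean value theorem on the segment turns the pairing into a quadratic form with
  matrix \<open>P\<close>, \<open>Q\<close>, \<open>R\<close>. Multiplying by \<open>P\<close> and
  completing the square shows its sign.\<close>

lemma symmetric_gradient_monotone:
  assumes \<alpha>: "has_gradient \<alpha> P Q" and \<beta>: "has_gradient \<beta> Q R"
    and pos: "\<And>z. P z > 0" and det: "\<And>z. P z * R z - (Q z)\<^sup>2 > 0"
  shows "0 \<le> fst (z - z') * (\<alpha> z - \<alpha> z') + snd (z - z') * (\<beta> z - \<beta> z')"
proof -
  define h where "h = z - z'"
  let ?z = "\<lambda>\<tau>. z' + \<tau> *\<^sub>R h"
  have "\<exists>\<xi>>0. \<xi> < 1 \<and> (fst h * \<alpha> (?z 1) + snd h * \<beta> (?z 1)) - (fst h * \<alpha> (?z 0) + snd h * \<beta> (?z 0)) =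
      (1 - 0) * (fst h * (fst h * P (?z \<xi>) + snd h * Q (?z \<xi>)) + snd h * (fst h * Q (?z \<xi>) + snd h * R (?z \<xi>)))"
    by (intro MVT2 DERIV_add DERIV_cmult has_gradient_line \<alpha> \<beta>) simp
  then obtain \<xi> where \<xi>: "fst h * (\<alpha> z - \<alpha> z') + snd h * (\<beta> z - \<beta> z') =
      fst h * (fst h * P (?z \<xi>) + snd h * Q (?z \<xi>)) + snd h * (fst h * Q (?z \<xi>) + snd h * R (?z \<xi>))"
    by (auto simp: h_def algebra_simps)
  have "P (?z \<xi>) * (fst h * (\<alpha> z - \<alpha> z') + snd h * (\<beta> z - \<beta> z')) =
      (fst h * P (?z \<xi>) + snd h * Q (?z \<xi>))\<^sup>2 + (snd h)\<^sup>2 * (P (?z \<xi>) * R (?z \<xi>) - (Q (?z \<xi>))\<^sup>2)"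
    unfolding \<xi> by (simp add: power2_eq_square algebra_simps)
  also have "\<dots> \<ge> 0"
    using det[of "?z \<xi>"] by simp
  finally show ?thesis
    using pos[of "?z \<xi>"] unfolding h_def by (simp add: zero_le_mult_iff)
qed

lemma Hessian_det_1_Beltrami_constant:
  assumes \<alpha>: "has_gradient \<alpha> P Q" and \<beta>: "has_gradient \<beta> Q R"
    and pos: "\<And>z. P z > 0" and det: "\<And>z. P z * R z - (Q z)\<^sup>2 = 1"
  shows "\<exists>c. \<forall>z. Complex (R z - P z) (2 * Q z) / of_real (2 + P z + R z) = c"
proof -
  \<comment> \<open>With \<open>u\<close> a potential of \<open>(\<alpha>, \<beta>)\<close>, these are the maps \<open>z + \<nabla>u\<close> and the conjugate of \<open>z - \<nabla>u\<close>;
    since the Hessian of \<open>u\<close> has determinant 1, \<open>h\<close> is holomorphic in the coordinate \<open>T\<close>.\<close>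
  define T where "T = (\<lambda>z. Complex (fst z + \<alpha> z) (snd z + \<beta> z))"
  define h where "h = (\<lambda>z. Complex (fst z - \<alpha> z) (\<beta> z - snd z))"
  define c where "c = (\<lambda>z. Complex (R z - P z) (2 * Q z) / of_real (2 + P z + R z))"
  have mono: "0 \<le> fst (z - z') * (\<alpha> z - \<alpha> z') + snd (z - z') * (\<beta> z - \<beta> z')" for z z'
    using \<alpha> \<beta> pos by (rule symmetric_gradient_monotone) (simp add: det)
  have R_pos: "R z > 0" for z
  proof -
    have "P z * R z > 0" using det[of z] zero_le_power2[of "Q z"] by linarith
    then show ?thesis using pos[of z] by (simp add: zero_less_mult_iff)
  qed
  \<comment> \<open>The squared norm on the right exceeds the one on the left by
    \<open>u\<^sup>2 + v\<^sup>2\<close> plus twice the monotone pairing.\<close>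
  have expand: "norm (z - z') \<le> norm (T z - T z')" for z z'
  proof -
    define x y u v where "x = fst (z - z')" and "y = snd (z - z')"
      and "u = \<alpha> z - \<alpha> z'" and "v = \<beta> z - \<beta> z'"
    have "0 \<le> u\<^sup>2 + v\<^sup>2 + 2 * (x * u + y * v)"
      using mono[of z z', folded x_def y_def u_def v_def] by simp
    then have "x\<^sup>2 + y\<^sup>2 \<le> (x + u)\<^sup>2 + (y + v)\<^sup>2"
      by (simp add: power2_eq_square algebra_simps)
    moreover have "T z - T z' = Complex (x + u) (y + v)"
      by (simp add: T_def x_def y_def u_def v_def complex_eq_iff)
    ultimately show ?thesis
      by (simp add: norm_prod_def complex_norm x_def y_def)
  qed
  \<comment> \<open>Here the squared norms differ by four times the monotone pairing.\<close>
  have contract: "norm (h z - h z') \<le> norm (T z - T z')" for z z'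
  proof -
    define x y u v where "x = fst (z - z')" and "y = snd (z - z')"
      and "u = \<alpha> z - \<alpha> z'" and "v = \<beta> z - \<beta> z'"
    have "0 \<le> 4 * (x * u + y * v)"
      using mono[of z z', folded x_def y_def u_def v_def] by simp
    then have "(x - u)\<^sup>2 + (v - y)\<^sup>2 \<le> (x + u)\<^sup>2 + (y + v)\<^sup>2"
      by (simp add: power2_eq_square algebra_simps)
    moreover have "T z - T z' = Complex (x + u) (y + v)" "h z - h z' = Complex (x - u) (v - y)"
      by (simp_all add: T_def h_def x_def y_def u_def v_def complex_eq_iff)
    ultimately show ?thesis by (simp add: complex_norm)
  qed
  have surj: "surj T"
  proof (rule expanding_imp_surj[OF _ expand])
    show "continuous_on UNIV T"
      unfolding T_def
      using has_gradient_continuous[OF \<alpha>] has_gradient_continuous[OF \<beta>] by (intro continuous_intros)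
  qed simp
  have deriv: "((\<lambda>\<zeta>. h (inv T \<zeta>)) has_field_derivative c z) (at (T z))" for z
  proof (rule complex_derivative_wrt_expanding[OF expand surj])
    let ?T' = "\<lambda>k. of_real (fst k + (P z * fst k + Q z * snd k)) + \<i> * of_real (snd k + (Q z * fst k + R z * snd k))"
    have T_eq: "T = (\<lambda>z. of_real (fst z + \<alpha> z) + \<i> * of_real (snd z + \<beta> z))"
      by (simp add: T_def fun_eq_iff complex_eq_iff)
    show "(T has_derivative ?T') (at z)"
      unfolding T_eq
      by (intro derivative_intros has_derivative_of_real has_gradientD[OF \<alpha>] has_gradientD[OF \<beta>])
    have h_eq: "h = (\<lambda>z. of_real (fst z - \<alpha> z) + \<i> * of_real (\<beta> z - snd z))"
      by (simp add: h_def fun_eq_iff complex_eq_iff)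
    have "(h has_derivative
       (\<lambda>k. of_real (fst k - (P z * fst k + Q z * snd k)) + \<i> * of_real ((Q z * fst k + R z * snd k) - snd k))) (at z)"
      unfolding h_eq
      by (intro derivative_intros has_derivative_of_real has_gradientD[OF \<alpha>] has_gradientD[OF \<beta>])
    moreover have "of_real (fst k - (P z * fst k + Q z * snd k)) + \<i> * of_real ((Q z * fst k + R z * snd k) - snd k)
        = c z * ?T' k" for k
    proof -
      define x y where "x = fst k" and "y = snd k"
      have pos2: "2 + P z + R z \<noteq> 0" using pos[of z] R_pos[of z] by simp
      \<comment> \<open>Real and imaginary parts of \<open>h' = c z * T'\<close> with the
        denominator cleared; both reduce to \<open>P z * R z - (Q z)\<^sup>2 = 1\<close>.\<close>
      have "(2 + P z + R z) * (x - (P z * x + Q z * y)) =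
          (R z - P z) * (x + (P z * x + Q z * y)) - 2 * Q z * (y + (Q z * x + R z * y))"
        "(2 + P z + R z) * (Q z * x + R z * y - y) =
          (R z - P z) * (y + (Q z * x + R z * y)) + 2 * Q z * (x + (P z * x + Q z * y))"
        using det[of z] by algebra+
      then have "of_real (2 + P z + R z) * (of_real (x - (P z * x + Q z * y)) + \<i> * of_real (Q z * x + R z * y - y))
         = Complex (R z - P z) (2 * Q z) * (of_real (x + (P z * x + Q z * y)) + \<i> * of_real (y + (Q z * x + R z * y)))"
        by (simp add: complex_eq_iff)
      then show ?thesis
        unfolding c_def x_def[symmetric] y_def[symmetric] using pos2
        by (simp add: nonzero_eq_divide_eq mult.commute del: of_real_add of_real_diff of_real_mult)
    qed
    ultimately show "(h has_derivative (\<lambda>k. c z * ?T' k)) (at z)" by (simp only:)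
  qed
  have T_inv: "T (inv T \<zeta>) = \<zeta>" for \<zeta> using surj by (rule surj_f_inv_f)
  have F: "((\<lambda>\<zeta>. h (inv T \<zeta>) ) has_field_derivative c (inv T \<zeta>)) (at \<zeta>)" for \<zeta>
    using deriv[of "inv T \<zeta>"] unfolding T_inv .
  have hol: "(\<lambda>\<zeta>. h (inv T \<zeta>)) holomorphic_on UNIV"
    using F by (auto simp: holomorphic_on_open)
  have growth: "norm (h (inv T \<zeta>) - h (inv T 0)) \<le> norm \<zeta>" for \<zeta>
    using contract[of "inv T \<zeta>" "inv T 0"] by (simp add: T_inv)
  have "c z = deriv (\<lambda>\<zeta>. h (inv T \<zeta>)) 0" for z
    using entire_linear_growth_imp_deriv_constant[OF hol growth, of "T z"] deriv[of z]
    by (simp add: DERIV_imp_deriv)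
  then show ?thesis unfolding c_def by blast
qed

subsection \<open>Space-like graphs\<close>

context zmc_graph
begin

text \<open>
  The induced metric divided by its area density has determinant 1, and the zero mean curvature
  equation says that its rows are closed forms: it is the Hessian of some function.
\<close>

lemma space_like_metric_closed:
  assumes space_like: "\<And>z. (p z)\<^sup>2 + (q z)\<^sup>2 < 1"
  defines "j \<equiv> \<lambda>z. inverse (sqrt (1 - (p z)\<^sup>2 - (q z)\<^sup>2))"
  obtains \<alpha> \<beta> where
    "has_gradient \<alpha> (\<lambda>z. (1 - (p z)\<^sup>2) * j z) (\<lambda>z. - (p z * q z) * j z)"
    "has_gradient \<beta> (\<lambda>z. - (p z * q z) * j z) (\<lambda>z. (1 - (q z)\<^sup>2) * j z)"
proof -
  have j2: "(j z)\<^sup>2 * (1 - (p z)\<^sup>2 - (q z)\<^sup>2) = 1" for z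
    using space_like[of z] by (simp add: j_def power_inverse)
  define u v where "u = (\<lambda>z. (j z)^3 * (p z * r z + q z * s z))"
    and "v = (\<lambda>z. (j z)^3 * (p z * s z + q z * t z))"
  have j: "has_gradient j u v"
  proof -
    have 1: "has_gradient (\<lambda>z. 1 - (p z)\<^sup>2 - (q z)\<^sup>2)
       (\<lambda>z. 0 - (r z * p z + p z * r z) - (s z * q z + q z * s z))
       (\<lambda>z. 0 - (s z * p z + p z * s z) - (t z * q z + q z * t z))"
      unfolding power2_eq_square
      by (intro has_gradient_diff has_gradient_mult has_gradient_const p q)
    have 2: "((\<lambda>x. inverse (sqrt x)) has_real_derivative - ((j z)^3 / 2)) (at (1 - (p z)\<^sup>2 - (q z)\<^sup>2))" for z
      using space_like[of z]
      by (auto intro!: derivative_eq_intros simp: j_def power3_eq_cube field_simps)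
    show ?thesis
      using has_gradient_DERIV[OF 1 2, folded j_def] by (simp add: u_def v_def algebra_simps)
  qed
  let ?P = "\<lambda>z. (1 - (p z)\<^sup>2) * j z" and ?Q = "\<lambda>z. - (p z * q z) * j z"
    and ?R = "\<lambda>z. (1 - (q z)\<^sup>2) * j z"
  define P1 P2 where "P1 = (\<lambda>z. - 2 * p z * r z * j z + (1 - (p z)\<^sup>2) * u z)"
    and "P2 = (\<lambda>z. - 2 * p z * s z * j z + (1 - (p z)\<^sup>2) * v z)"
  define Q1 Q2 where "Q1 = (\<lambda>z. - (r z * q z + p z * s z) * j z - p z * q z * u z)"
    and "Q2 = (\<lambda>z. - (s z * q z + p z * t z) * j z - p z * q z * v z)"
  define R1 R2 where "R1 = (\<lambda>z. - 2 * q z * s z * j z + (1 - (q z)\<^sup>2) * u z)"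
    and "R2 = (\<lambda>z. - 2 * q z * t z * j z + (1 - (q z)\<^sup>2) * v z)"
  have P: "has_gradient ?P P1 P2"
    using has_gradient_mult[OF has_gradient_diff[OF has_gradient_const[of 1] has_gradient_mult[OF p p]] j]
    by (simp add: P1_def P2_def power2_eq_square algebra_simps)
  have Q: "has_gradient ?Q Q1 Q2"
    using has_gradient_mult[OF has_gradient_diff[OF has_gradient_const[of 0] has_gradient_mult[OF p q]] j]
    by (simp add: Q1_def Q2_def algebra_simps)
  have R: "has_gradient ?R R1 R2"
    using has_gradient_mult[OF has_gradient_diff[OF has_gradient_const[of 1] has_gradient_mult[OF q q]] j]
    by (simp add: R1_def R2_def power2_eq_square algebra_simps)
  \<comment> \<open>After \<open>j\<close> is replaced by \<open>j^3 * (1 - p^2 - q^2)\<close>,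
    \<open>P2 - Q1\<close> is \<open>j^3 * q\<close> times the left side of \<open>zmc\<close>.
    Likewise \<open>Q2 - R1\<close> below is \<open>- j^3 * p\<close> times it.\<close>
  have "P2 = Q1"
  proof
    fix z
    show "P2 z = Q1 z"
      using j2[of z] zmc[of z] unfolding P2_def Q1_def u_def v_def by algebra
  qed
  have "Q2 = R1"
  proof
    fix z
    show "Q2 z = R1 z"
      using j2[of z] zmc[of z] unfolding Q2_def R1_def u_def v_def by algebra
  qed
  note [continuous_intros] =
    has_gradient_continuous[OF p] has_gradient_continuous[OF q] has_gradient_continuous[OF r]
    has_gradient_continuous[OF s] has_gradient_continuous[OF t] has_gradient_continuous[OF j]
  have "continuous_on UNIV P1" "continuous_on UNIV Q1" "continuous_on UNIV Q2" "continuous_on UNIV R2"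
    unfolding P1_def Q1_def Q2_def R2_def u_def v_def by (intro continuous_intros)+
  with \<open>P2 = Q1\<close> \<open>Q2 = R1\<close> have cont: "continuous_on UNIV P1" "continuous_on UNIV P2"
    "continuous_on UNIV Q1" "continuous_on UNIV Q2" "continuous_on UNIV R1" "continuous_on UNIV R2"
    by simp_all
  obtain \<alpha> where \<alpha>: "has_gradient \<alpha> ?P ?Q"
    using closed_form_has_potential[OF P Q[folded \<open>P2 = Q1\<close>] cont(1,2,4)] .
  obtain \<beta> where "has_gradient \<beta> ?Q ?R"
    using closed_form_has_potential[OF Q R[folded \<open>Q2 = R1\<close>] cont(3,4,6)] .
  with \<alpha> show thesis by (rule that)
qed

lemma space_like_imp_constant_gradient:
  assumes space_like: "\<And>z. (p z)\<^sup>2 + (q z)\<^sup>2 < 1"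
  shows "\<exists>a b. \<forall>z. p z = a \<and> q z = b"
proof -
  define W where "W = (\<lambda>z. sqrt (1 - (p z)\<^sup>2 - (q z)\<^sup>2))"
  have W: "W z > 0" "(W z)\<^sup>2 = 1 - (p z)\<^sup>2 - (q z)\<^sup>2" for z
    using space_like[of z] by (simp_all add: W_def)
  define P Q R where "P = (\<lambda>z. (1 - (p z)\<^sup>2) * inverse (W z))"
    and "Q = (\<lambda>z. - (p z * q z) * inverse (W z))" and "R = (\<lambda>z. (1 - (q z)\<^sup>2) * inverse (W z))"
  obtain \<alpha> \<beta> where \<alpha>\<beta>: "has_gradient \<alpha> P Q" "has_gradient \<beta> Q R"
    using space_like_metric_closed[OF space_like] unfolding P_def Q_def R_def W_def by blast
  have "P z > 0" for z
  proof -
    have "(p z)\<^sup>2 < 1" using space_like[of z] zero_le_power2[of "q z"] by linarith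
    then show ?thesis using W(1)[of z] by (simp add: P_def)
  qed
  moreover have "P z * R z - (Q z)\<^sup>2 = 1" for z
  proof -
    have "inverse (W z) * W z = 1" using W(1)[of z] by simp
    then show ?thesis using W(2)[of z] unfolding P_def Q_def R_def by algebra
  qed
  ultimately obtain c where c: "\<And>z. Complex (R z - P z) (2 * Q z) / of_real (2 + P z + R z) = c"
    using Hessian_det_1_Beltrami_constant[OF \<alpha>\<beta>] by blast
  \<comment> \<open>\<open>m\<close> is a continuous square root of the constant \<open>c\<close>, so it takes at most two values.\<close>
  define m where "m = (\<lambda>z. Complex (p z / (1 + W z)) (- (q z / (1 + W z))))"
  have "(m z)\<^sup>2 = c" for z
  proof -
    have pos: "W z \<noteq> 0" "1 + W z \<noteq> 0" using W(1)[of z] by simp_all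
    \<comment> \<open>This square in the denominator is what makes \<open>c\<close> the square of
      \<open>m z\<close>.\<close>
    have 2: "2 + P z + R z = (1 + W z)\<^sup>2 / W z"
    proof -
      have "2 + P z + R z = (2 * W z + (1 - (p z)\<^sup>2) + (1 - (q z)\<^sup>2)) / W z"
        using pos unfolding P_def R_def by (simp add: field_simps)
      also have "2 * W z + (1 - (p z)\<^sup>2) + (1 - (q z)\<^sup>2) = (1 + W z)\<^sup>2"
        using W(2)[of z] by (simp add: power2_sum)
      finally show ?thesis .
    qed
    have "(R z - P z) / (2 + P z + R z) = ((p z)\<^sup>2 - (q z)\<^sup>2) / (1 + W z)\<^sup>2"
      unfolding 2 using pos by (simp add: P_def R_def field_simps)
    moreover have "(2 * Q z) / (2 + P z + R z) = - (2 * p z * q z) / (1 + W z)\<^sup>2"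
      unfolding 2 using pos by (simp add: Q_def field_simps)
    ultimately show ?thesis
      unfolding c[of z, symmetric] m_def
      by (simp add: complex_eq_iff power2_eq_square diff_divide_distrib)
  qed
  then have "m z \<in> {csqrt c, - csqrt c}" for z
    using power2_eq_iff[of "m z" "csqrt c"] by simp
  then have "range m \<subseteq> {csqrt c, - csqrt c}" by (rule image_subsetI)
  then have "finite (range m)" by (rule finite_subset) simp
  moreover have "continuous_on UNIV m"
  proof -
    have "1 + W z \<noteq> 0" for z using W(1)[of z] by simp
    then show ?thesis
      unfolding m_def W_def
      using has_gradient_continuous[OF p] has_gradient_continuous[OF q]
      by (intro continuous_intros) auto
  qed
  \<comment> \<open>A continuous function with finite range is constant on the connected
    plane.\<close>
  ultimately have "m constant_on UNIV"
    by (intro continuous_finite_range_constant) auto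
  then obtain m0 where m0: "m z = m0" for z
    unfolding constant_on_def by auto
  define x y where "x = Re m0" and "y = - Im m0"
  have xy: "x = p z / (1 + W z)" "y = q z / (1 + W z)" for z
    using m0[of z] by (auto simp: m_def x_def y_def)
  \<comment> \<open>\<open>W\<close> is recovered from the constants:
    \<open>x\<^sup>2 + y\<^sup>2 = (1 - W z) / (1 + W z)\<close>, because
    \<open>1 - (W z)\<^sup>2\<close> is the squared length of the gradient.\<close>
  have "1 + W z = 2 / (1 + x\<^sup>2 + y\<^sup>2)" for z
  proof -
    have pos: "1 + W z > 0" using W(1)[of z] by simp
    then have "p z = x * (1 + W z)" "q z = y * (1 + W z)" using xy[of z] by simp_all
    then have "(1 + W z) * (1 - W z) = (1 + W z) * ((x\<^sup>2 + y\<^sup>2) * (1 + W z))"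
      using W(2)[of z] by algebra
    then have "1 - W z = (x\<^sup>2 + y\<^sup>2) * (1 + W z)" using pos by simp
    moreover have "1 + x\<^sup>2 + y\<^sup>2 > 0" by (simp add: add_pos_nonneg)
    ultimately show ?thesis by (simp add: field_simps)
  qed
  moreover have "p z = x * (1 + W z)" "q z = y * (1 + W z)" for z
    using xy[of z] W(1)[of z] by simp_all
  ultimately have "p z = x * (2 / (1 + x\<^sup>2 + y\<^sup>2))" "q z = y * (2 / (1 + x\<^sup>2 + y\<^sup>2))" for z
    by simp_all
  then show ?thesis by (intro exI allI conjI)
qed

section \<open>The two cases combined\<close>

lemma affine: "\<exists>c a b. \<forall>z. \<psi> z = c + a * fst z + b * snd z"
proof (cases "\<exists>z0. (p z0)\<^sup>2 + (q z0)\<^sup>2 = 1")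
  case True
  then obtain z0 where "(p z0)\<^sup>2 + (q z0)\<^sup>2 = 1" ..
  then have "\<psi> z = (\<psi> z0 - p z0 * fst z0 - q z0 * snd z0) + p z0 * fst z + q z0 * snd z" for z
    using light_like_imp_affine[of z0 z] by (simp add: algebra_simps)
  then show ?thesis by (intro exI allI)
next
  case False
  then have "(p z)\<^sup>2 + (q z)\<^sup>2 < 1" for z
    using gradient_le_1[of z] False by (metis less_le)
  then obtain a b where ab: "\<And>z. p z = a" "\<And>z. q z = b"
    using space_like_imp_constant_gradient by metis
  have grad: "has_gradient (\<lambda>z. \<psi> z - (a * fst z + b * snd z)) (\<lambda>_. 0) (\<lambda>_. 0)"
    using has_gradient_diff[OF \<psi> has_gradient_linear[of a b]] by (simp add: ab)
  have "\<psi> z = \<psi> 0 + a * fst z + b * snd z" for z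
    using has_gradient_zero_imp_constant[OF grad, of z 0] by (simp add: algebra_simps)
  then show ?thesis by (intro exI allI)
qed

end

section \<open>Transfer to C^3 functions\<close>

lemma linear_of_affine:
  fixes f :: "real \<times> real \<Rightarrow> real"
  assumes "\<And>z. f z = c + a * fst z + b * snd z"
  shows "linear (\<lambda>z. f z - f (0, 0))"
  by (intro linearI) (simp_all add: assms algebra_simps)

theorem corollaryB:
  fixes \<psi> :: "real \<times> real \<Rightarrow> real"
  assumes "C_k 3 \<psi>"
    and "\<And>p. zero_mean_curvature_at \<psi> p"
    and "\<And>p. \<not> time_like \<psi> p"
  shows "linear (\<lambda>p. \<psi> p - \<psi> (0, 0))"
proof -
  define p q where "p = partial_x \<psi>" and "q = partial_y \<psi>"
  define r s t where "r = partial_x p" and "s = partial_y p" and "t = partial_y q"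
  have C: "C_k (Suc (Suc (Suc 0))) \<psi>" using assms(1) by (simp only: numeral_3_eq_3)
  then have C2: "C_k (Suc (Suc 0)) p" "C_k (Suc (Suc 0)) q"
    unfolding p_def q_def C_k.simps(2)[of _ \<psi>] by blast+
  then have C1: "C_k (Suc 0) r" "C_k (Suc 0) s" "C_k (Suc 0) (partial_x q)" "C_k (Suc 0) t"
    unfolding r_def s_def t_def C_k.simps(2)[of _ p] C_k.simps(2)[of _ q] by blast+
  have \<psi>: "has_gradient \<psi> p q" using C_k_has_gradient[OF C] by (simp add: p_def q_def)
  have p: "has_gradient p r s" using C_k_has_gradient[OF C2(1)] by (simp add: r_def s_def)
  have "has_gradient q (partial_x q) t" using C_k_has_gradient[OF C2(2)] by (simp add: t_def)
  \<comment> \<open>Symmetry identifies the x-partial of \<open>q\<close> with \<open>s\<close>, as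
    the locale's shared \<open>s\<close> demands.\<close>
  moreover from mixed_partials_eq[OF \<psi> p this C_k_imp_continuous[OF C1(2)] C_k_imp_continuous[OF C1(3)]]
  have "partial_x q = s" by auto
  ultimately have q: "has_gradient q s t" by simp
  interpret zmc_graph \<psi> p q r s t "partial_x r" "partial_y r" "partial_x s" "partial_y s"
    "partial_x t" "partial_y t"
  proof
    show "has_gradient r (partial_x r) (partial_y r)" "has_gradient s (partial_x s) (partial_y s)"
      "has_gradient t (partial_x t) (partial_y t)"
      by (rule C_k_has_gradient, fact)+
    have "continuous_on UNIV (partial_x f) \<and> continuous_on UNIV (partial_y f)" if "C_k (Suc 0) f" for f
      using that unfolding C_k.simps by blast
    with C1 show "continuous_on UNIV (partial_x r)" "continuous_on UNIV (partial_y r)"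
      "continuous_on UNIV (partial_x s)" "continuous_on UNIV (partial_y s)"
      "continuous_on UNIV (partial_x t)" "continuous_on UNIV (partial_y t)" by blast+
    show "(1 - (q z)\<^sup>2) * r z + 2 * p z * q z * s z + (1 - (p z)\<^sup>2) * t z = 0" for z
      using assms(2)[of z] by (simp add: zero_mean_curvature_at_def p_def q_def r_def s_def t_def)
    show "(p z)\<^sup>2 + (q z)\<^sup>2 \<le> 1" for z
      using assms(3)[of z] by (simp add: time_like_def B_def p_def q_def)
  qed (fact \<psi> p q)+
  obtain c a b where "\<And>z. \<psi> z = c + a * fst z + b * snd z" using affine by auto
  then show ?thesis by (rule linear_of_affine)
qed

end
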